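(* Let $d\geq 3$ and $n\geq 2d$ be integers, and let $K_n$ be the complete graph on $n$ vertices. If $n$ is divisible by $2d$, then $a_d(K_n)\geq \frac{n}{2d}$. For general $n\geq 2d$, $a_d(K_n)\geq \left\lceil\frac{n}{2d}\right\rceil-2d+1$.
   Context: For a graph $G=(V,E)$ and a map $p:V\to\mathbb{R}^d$, for distinct $u,v\in V$ let $d_{uv}=\frac{p(u)-p(v)}{\|p(u)-p(v)\|}$ if $p(u)\neq p(v)$ and $d_{uv}=0$ otherwise. The normalized rigidity matrix $R(G,p)$ is the $d|V|\times|E|$ real matrix whose column indexed by the edge $\{u,v\}$ is $(1_u-1_v)\otimes d_{uv}$, where $\{1_u\}$ is the standard basis of $\mathbb{R}^{|V|}$ and $\otimes$ is the Kronecker product. The stiffness matrix is $L(G,p)=R(G,p)R(G,p)^t$. For a symmetric matrix $M$, $\lambda_i(M)$ denotes its $i$-th smallest eigenvalue. The $d$-dimensional algebraic connectivity of $G$ is $a_d(G)=\sup\{\lambda_{\binom{d+1}{2}+1}(L(G,p)) : p:V\to\mathbb{R}^d\}$. *)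

theory Defs
  imports "Jordan_Normal_Form.Char_Poly" "HOL-Library.Multiset" "HOL-Library.FuncSet"
begin

text \<open>A finite simple graph is given by its number of vertices \<open>n\<close>, the vertex set being
  \<open>{0..<n}\<close>, and its set \<open>E\<close> of edges, which are two-element subsets of the vertex set. A map
  into \<open>d\<close>-dimensional real space is a map from \<open>{0..<n}\<close> to \<open>carrier_vec d\<close>.\<close>

definition complete_edges :: "nat \<Rightarrow> nat set set" where
  "complete_edges n = {{u, v} | u v. u < n \<and> v < n \<and> u \<noteq> v}"

definition eucl_norm :: "real vec \<Rightarrow> real" where
  "eucl_norm x = sqrt (x \<bullet> x)"

definition unit_direction :: "nat \<Rightarrow> (nat \<Rightarrow> real vec) \<Rightarrow> nat \<Rightarrow> nat \<Rightarrow> real vec" where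
  "unit_direction d p u v =
    (if p u \<noteq> p v then (1 / eucl_norm (p u - p v)) \<cdot>\<^sub>v (p u - p v) else 0\<^sub>v d)"

definition kronecker_vec :: "real vec \<Rightarrow> real vec \<Rightarrow> real vec" where
  "kronecker_vec x y =
    vec (dim_vec x * dim_vec y) (\<lambda>i. x $ (i div dim_vec y) * y $ (i mod dim_vec y))"

text \<open>Columns of a matrix are numbered, so the edges are put into a list, in lexicographic order;
  each edge occurs once, as the pair \<open>(u, v)\<close> with \<open>u < v\<close>. The orientation is immaterial,
  since swapping \<open>u\<close> and \<open>v\<close> negates both factors of the Kronecker product below.\<close>

definition edge_list :: "nat \<Rightarrow> nat set set \<Rightarrow> (nat \<times> nat) list" where
  "edge_list n E =
    filter (\<lambda>(u, v). u < v \<and> {u, v} \<in> E) (List.product [0..<n] [0..<n])"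

definition rigidity_matrix ::
  "nat \<Rightarrow> nat \<Rightarrow> nat set set \<Rightarrow> (nat \<Rightarrow> real vec) \<Rightarrow> real mat" where
  "rigidity_matrix d n E p =
    mat_of_cols (d * n)
      (map (\<lambda>(u, v). kronecker_vec (unit_vec n u - unit_vec n v) (unit_direction d p u v))
        (edge_list n E))"

definition stiffness_matrix ::
  "nat \<Rightarrow> nat \<Rightarrow> nat set set \<Rightarrow> (nat \<Rightarrow> real vec) \<Rightarrow> real mat" where
  "stiffness_matrix d n E p =
    rigidity_matrix d n E p * transpose_mat (rigidity_matrix d n E p)"

text \<open>The \<open>i\<close>-th smallest eigenvalue, counted from \<open>i = 1\<close> and with multiplicity. A symmetric
  real matrix of size \<open>N\<close> has \<open>N\<close> real eigenvalues, so the list has length \<open>N\<close>; the value is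
  meaningful for \<open>1 \<le> i \<le> N\<close>.\<close>

definition sorted_eigenvalues :: "real mat \<Rightarrow> real list" where
  "sorted_eigenvalues M = sorted_list_of_multiset (proots (char_poly M))"

definition nth_eigenvalue :: "nat \<Rightarrow> real mat \<Rightarrow> real" where
  "nth_eigenvalue i M = sorted_eigenvalues M ! (i - 1)"

definition algebraic_connectivity :: "nat \<Rightarrow> nat \<Rightarrow> nat set set \<Rightarrow> real" where
  "algebraic_connectivity d n E =
    (SUP p \<in> {0..<n} \<rightarrow> carrier_vec d.
      nth_eigenvalue (((d + 1) choose 2) + 1) (stiffness_matrix d n E p))"

end

theory Submission
  imports Defs "Jordan_Normal_Form.Spectral_Radius"
begin

text \<open>
  Distribute the vertices evenly over the vertices \<open>\<plusminus>e\<^sub>i\<close> of the cross-polytope. Splitting a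
  displacement into its class means and its deviations from them, the quadratic form of the
  stiffness matrix decouples. On the deviations it is at least the size of the smallest class,
  because the directions from a vertex of the cross-polytope to the other ones dominate an
  orthonormal frame. On the means, the parts of the displacement that are even and odd under
  \<open>e\<^sub>i \<mapsto> -e\<^sub>i\<close> decouple again, and for \<open>2d\<close> points the form is at least the squared norm once
  \<open>d\<close> translational and \<open>d choose 2\<close> rotational linear conditions are imposed. By the min-max
  principle, \<open>(d + 1) choose 2\<close> linear conditions bound the eigenvalue of the next index.
\<close>

section \<open>Eigenvalues of real symmetric matrices\<close>

text \<open>The complex spectrum is nonempty. For an eigenvector \<open>w\<close>, the Hermitian
  form \<open>q\<close> of \<open>A\<close> at \<open>w\<close> is its own conjugate because
  \<open>A\<close> is real and symmetric, and it equals \<open>k * s\<close> with \<open>s\<close>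
  real and nonzero; hence \<open>k\<close> is real.\<close>

lemma symmetric_real_eigenvalue:
  fixes A :: "real mat"
  assumes A: "A \<in> carrier_mat n n" and sym: "transpose_mat A = A" and n: "n > 0"
  obtains e where "eigenvalue A e"
proof -
  let ?C = "map_mat complex_of_real A"
  have C: "?C \<in> carrier_mat n n" using A by simp
  from spectrum_non_empty[OF C n] obtain k where "k \<in> spectrum ?C" by auto
  hence ev: "eigenvalue ?C k" unfolding spectrum_def by simp
  then obtain w where w: "w \<in> carrier_vec n" "w \<noteq> 0\<^sub>v n" and Cw: "?C *\<^sub>v w = k \<cdot>\<^sub>v w"
    unfolding eigenvalue_def eigenvector_def using C by auto
  define s where "s = (\<Sum>i<n. cnj (w $ i) * (w $ i))"
  define q where "q = (\<Sum>i<n. \<Sum>j<n. cnj (w $ i) * of_real (A $$ (i,j)) * w $ j)"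
  have symij: "A $$ (i,j) = A $$ (j,i)" if "i < n" "j < n" for i j
    using that A sym by (metis carrier_matD(1) carrier_matD(2) index_transpose_mat(1))
  have "q = (\<Sum>i<n. cnj (w $ i) * (k * w $ i))" unfolding q_def
  proof (rule sum.cong[OF refl])
    fix i assume i: "i \<in> {..<n}"
    have "(?C *\<^sub>v w) $ i = (\<Sum>j<n. of_real (A $$ (i,j)) * w $ j)"
      using i A w(1) by (auto simp: scalar_prod_def lessThan_atLeast0)
    moreover have "(?C *\<^sub>v w) $ i = k * w $ i" unfolding Cw using i w(1) by auto
    ultimately show "(\<Sum>j<n. cnj (w $ i) * of_real (A $$ (i,j)) * w $ j) = cnj (w $ i) * (k * w $ i)"
      by (simp add: sum_distrib_left mult.assoc)
  qed
  hence qs: "q = k * s" unfolding s_def by (simp add: sum_distrib_left algebra_simps)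
  have "cnj q = (\<Sum>i<n. \<Sum>j<n. w $ i * of_real (A $$ (i,j)) * cnj (w $ j))"
    unfolding q_def by simp
  also have "\<dots> = (\<Sum>j<n. \<Sum>i<n. w $ i * of_real (A $$ (i,j)) * cnj (w $ j))"
    by (rule sum.swap)
  also have "\<dots> = q" unfolding q_def
    by (intro sum.cong[OF refl]) (auto simp: symij mult_ac)
  finally have qr: "cnj q = q" .
  have s: "s = of_real (\<Sum>i<n. (cmod (w $ i))^2)"
    unfolding s_def of_real_sum
    by (intro sum.cong[OF refl]) (metis complex_norm_square mult.commute of_real_power)
  have "s \<noteq> 0"
  proof
    assume "s = 0"
    hence "(\<Sum>i<n. (cmod (w $ i))^2) = 0" unfolding s by (simp only: of_real_eq_0_iff)
    hence "\<forall>i<n. w $ i = 0" by (simp add: sum_nonneg_eq_0_iff)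
    thus False using w by (metis eq_vecI carrier_vecD index_zero_vec)
  qed
  moreover have "cnj s = s" unfolding s by simp
  ultimately have "cnj k = k" using qs qr by (metis complex_cnj_mult mult_right_cancel)
  then obtain e where k: "k = of_real e" by (metis Reals_cnj_iff Reals_cases)
  have "poly (char_poly ?C) k = 0" using ev eigenvalue_root_char_poly[OF C] by simp
  hence "poly (map_poly complex_of_real (char_poly A)) (of_real e) = 0"
    unfolding k of_real_hom.char_poly_hom[OF A] .
  hence "poly (char_poly A) e = 0" by simp
  thus thesis using that eigenvalue_root_char_poly[OF A] by simp
qed

text \<open>Prepares the deflation below. Gram-Schmidt on a basis that begins with \<open>v\<close>
  keeps \<open>v\<close> in front, and normalizing only rescales it; the value of \<open>c\<close>
  is left open since multiples of an eigenvector serve equally well.\<close>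

lemma orthogonal_matrix_with_first_column:
  fixes v :: "real vec"
  assumes v: "v \<in> carrier_vec n" and v0: "v \<noteq> 0\<^sub>v n"
  obtains W c where "W \<in> carrier_mat n n" "transpose_mat W * W = 1\<^sub>m n" "col W 0 = c \<cdot>\<^sub>v v"
proof -
  define ws where "ws = gram_schmidt n (basis_completion v)"
  interpret cof_vec_space n "TYPE(real)" .
  note bc = basis_completion[OF v v0]
  have n: "n \<noteq> 0" using v v0 by auto
  obtain vs where bv: "basis_completion v = v # vs"
    using bc(6,7) n by (cases "basis_completion v") auto
  have ws: "set ws \<subseteq> carrier_vec n" "corthogonal ws" "length ws = n"
    using gram_schmidt_result[OF bc(2,4,5) refl, folded ws_def] bc(6) by auto
  have hd: "hd ws = v" using gram_schmidt_hd[OF v, of vs, folded bv] unfolding ws_def .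
  have wsc: "ws ! i \<in> carrier_vec n" if "i < n" for i using ws that by auto
  have orth: "ws ! i \<bullet> ws ! j = 0 \<longleftrightarrow> i \<noteq> j" if "i < n" "j < n" for i j
    using corthogonalD[OF ws(2)] that ws(3) by (simp add: conjugate_vec_def eq_vecI)
  have pos: "ws ! i \<bullet> ws ! i > 0" if "i < n" for i
  proof -
    have "ws ! i \<bullet> ws ! i \<ge> 0" by (auto simp: scalar_prod_def intro!: sum_nonneg)
    thus ?thesis using orth[OF that that] by auto
  qed
  define us where "us = map (\<lambda>w. (1 / eucl_norm w) \<cdot>\<^sub>v w) ws"
  define W where "W = mat_of_cols n us"
  have W: "W \<in> carrier_mat n n" using ws unfolding W_def us_def by auto
  have colW: "col W i = (1 / eucl_norm (ws ! i)) \<cdot>\<^sub>v (ws ! i)" if "i < n" for i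
    unfolding W_def us_def using that ws wsc by (subst col_mat_of_cols) auto
  have "transpose_mat W * W = 1\<^sub>m n"
  proof (rule eq_matI)
    fix i j assume "i < dim_row (1\<^sub>m n)" "j < dim_col (1\<^sub>m n)"
    hence i: "i < n" and j: "j < n" by auto
    have "(transpose_mat W * W) $$ (i,j) = col W i \<bullet> col W j"
      using W i j by auto
    also have "\<dots> = (ws ! i \<bullet> ws ! j) / (eucl_norm (ws ! i) * eucl_norm (ws ! j))"
      unfolding colW[OF i] colW[OF j] using wsc[OF i] wsc[OF j] by auto
    also have "\<dots> = (if i = j then 1 else 0)"
      using orth[OF i j] pos[OF i] by (auto simp: eucl_norm_def)
    finally show "(transpose_mat W * W) $$ (i,j) = 1\<^sub>m n $$ (i,j)" using i j by simp
  qed (use W in auto)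
  moreover have "ws ! 0 = v" using hd hd_conv_nth[of ws] ws(3) n by (metis list.size(3))
  hence "col W 0 = (1 / eucl_norm v) \<cdot>\<^sub>v v" using colW[of 0] n by auto
  ultimately show thesis using that W by blast
qed

text \<open>Deflation: in an orthonormal basis that starts with an eigenvector, the matrix splits
  into a one-by-one block and a smaller symmetric matrix, to which the induction hypothesis
  applies.\<close>

lemma real_symmetric_diagonalization:
  fixes A :: "real mat"
  assumes "A \<in> carrier_mat n n" "transpose_mat A = A"
  shows "\<exists>P D. P \<in> carrier_mat n n \<and> D \<in> carrier_mat n n \<and> transpose_mat P * P = 1\<^sub>m n \<and>
    diagonal_mat D \<and> A = P * D * transpose_mat P"
  using assms
proof (induction n arbitrary: A)
  case 0
  thus ?case by (intro exI[of _ "1\<^sub>m 0"]) (auto simp: diagonal_mat_def)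
next
  case (Suc n A)
  let ?N = "Suc n"
  note A = Suc.prems(1) and sym = Suc.prems(2)
  obtain e where "eigenvalue A e" using symmetric_real_eigenvalue[OF A sym] by blast
  then obtain v where v: "v \<in> carrier_vec ?N" "v \<noteq> 0\<^sub>v ?N" and Av: "A *\<^sub>v v = e \<cdot>\<^sub>v v"
    unfolding eigenvalue_def eigenvector_def using A by auto
  obtain W c where W: "W \<in> carrier_mat ?N ?N" and WtW: "transpose_mat W * W = 1\<^sub>m ?N"
    and colW: "col W 0 = c \<cdot>\<^sub>v v" using orthogonal_matrix_with_first_column[OF v] by metis
  have Wt: "transpose_mat W \<in> carrier_mat ?N ?N" using W by simp
  have WWt: "W * transpose_mat W = 1\<^sub>m ?N" by (rule mat_mult_left_right_inverse[OF Wt W WtW])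
  define B where "B = transpose_mat W * A * W"
  have B: "B \<in> carrier_mat ?N ?N" unfolding B_def using W A by simp
  have symB: "transpose_mat B = B" unfolding B_def
    using W A Wt sym by (simp add: transpose_mult[of _ ?N ?N _ ?N] assoc_mult_mat[of _ ?N ?N _ ?N _ ?N])
  have Aeq: "A = W * B * transpose_mat W"
  proof -
    have "W * B * transpose_mat W = (W * transpose_mat W) * A * (W * transpose_mat W)"
      unfolding B_def using W A Wt by (simp add: assoc_mult_mat[of _ ?N ?N _ ?N _ ?N])
    thus ?thesis using A WWt by simp
  qed
  \<comment> \<open>The first column of \<open>W\<close> is an eigenvector and the columns are
    orthonormal, so the first column of \<open>B\<close> is \<open>e\<close> times the first unit
    vector. Symmetry then gives the first row.\<close>
  have B0: "B $$ (i,0) = (if i = 0 then e else 0)" if i: "i < ?N" for i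
  proof -
    have "B = transpose_mat W * (A * W)" unfolding B_def using W A Wt by simp
    hence "B $$ (i,0) = col W i \<bullet> (A *\<^sub>v col W 0)" using i W A by (simp add: mult_mat_vec_def)
    also have "A *\<^sub>v col W 0 = e \<cdot>\<^sub>v col W 0" unfolding colW
      using A v Av by (simp add: mult_mat_vec[OF A v(1)] smult_smult_assoc mult.commute)
    also have "col W i \<bullet> (e \<cdot>\<^sub>v col W 0) = e * (transpose_mat W * W) $$ (i,0)"
      using i W by simp
    finally show ?thesis using i unfolding WtW by simp
  qed
  have B0': "B $$ (0,i) = (if i = 0 then e else 0)" if i: "i < ?N" for i
    using B0[OF i] symB B i by (metis carrier_matD(1) carrier_matD(2) index_transpose_mat(1) zero_less_Suc)
  define E where "E = mat 1 1 (\<lambda>_. e)"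
  define C where "C = mat n n (\<lambda>(i,j). B $$ (Suc i, Suc j))"
  have C: "C \<in> carrier_mat n n" unfolding C_def by simp
  have Bsym: "B $$ (i,j) = B $$ (j,i)" if "i < ?N" "j < ?N" for i j
    using symB B that by (metis carrier_matD(1) carrier_matD(2) index_transpose_mat(1))
  have symC: "transpose_mat C = C"
    by (rule eq_matI) (auto simp: C_def intro: Bsym)
  have Bblock: "B = four_block_mat E (0\<^sub>m 1 n) (0\<^sub>m n 1) C"
    by (rule eq_matI) (use B B0 B0' in \<open>auto simp: E_def C_def\<close>)
  obtain P D where P: "P \<in> carrier_mat n n" and D: "D \<in> carrier_mat n n"
    and PtP: "transpose_mat P * P = 1\<^sub>m n" and diag: "diagonal_mat D"
    and CP: "C = P * D * transpose_mat P" using Suc.IH[OF C symC] by blast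
  \<comment> \<open>The change of basis for the remainder \<open>C\<close> fixes the eigenvector
    already split off; \<open>W * Q\<close> will diagonalize \<open>A\<close>.\<close>
  define Q where "Q = four_block_mat (1\<^sub>m 1) (0\<^sub>m 1 n) (0\<^sub>m n 1) P"
  define F where "F = four_block_mat E (0\<^sub>m 1 n) (0\<^sub>m n 1) D"
  have E: "E \<in> carrier_mat 1 1" unfolding E_def by simp
  have Pt: "transpose_mat P \<in> carrier_mat n n" using P by simp
  have PD: "P * D \<in> carrier_mat n n" using P D by simp
  have Q: "Q \<in> carrier_mat ?N ?N" and F: "F \<in> carrier_mat ?N ?N"
    unfolding Q_def F_def carrier_mat_def using P E D by auto
  have Qt: "transpose_mat Q = four_block_mat (1\<^sub>m 1) (0\<^sub>m 1 n) (0\<^sub>m n 1) (transpose_mat P)"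
    unfolding Q_def by (subst transpose_four_block_mat[OF one_carrier_mat zero_carrier_mat zero_carrier_mat P]) auto
  have Qtc: "transpose_mat Q \<in> carrier_mat ?N ?N" using Q by simp
  have QtQ: "transpose_mat Q * Q = 1\<^sub>m ?N" unfolding Qt unfolding Q_def
    by (subst mult_four_block_mat[OF one_carrier_mat zero_carrier_mat zero_carrier_mat Pt
          one_carrier_mat zero_carrier_mat zero_carrier_mat P]) (use P PtP in auto)
  have "Q * F = four_block_mat E (0\<^sub>m 1 n) (0\<^sub>m n 1) (P * D)" unfolding Q_def F_def
    by (subst mult_four_block_mat[OF one_carrier_mat zero_carrier_mat zero_carrier_mat P
          E zero_carrier_mat zero_carrier_mat D]) (use P D E in auto)
  hence "Q * F * transpose_mat Q = four_block_mat E (0\<^sub>m 1 n) (0\<^sub>m n 1) (P * D) *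
      four_block_mat (1\<^sub>m 1) (0\<^sub>m 1 n) (0\<^sub>m n 1) (transpose_mat P)" unfolding Qt by (rule arg_cong)
  also have "\<dots> = B" unfolding Bblock CP
    by (subst mult_four_block_mat[OF E zero_carrier_mat zero_carrier_mat PD
          one_carrier_mat zero_carrier_mat zero_carrier_mat Pt]) (use P D E in auto)
  finally have BQ: "B = Q * F * transpose_mat Q" by simp
  have "diagonal_mat F" unfolding diagonal_mat_def F_def E_def
    using diag D unfolding diagonal_mat_def by auto
  moreover have "A = (W * Q) * F * transpose_mat (W * Q)" unfolding Aeq BQ
    using W Wt Q Qtc F
    by (simp add: transpose_mult[of _ ?N ?N _ ?N] assoc_mult_mat[of _ ?N ?N _ ?N _ ?N])
  moreover have "transpose_mat (W * Q) * (W * Q) = transpose_mat Q * (transpose_mat W * W) * Q"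
    using W Wt Q Qtc
    by (simp add: transpose_mult[of _ ?N ?N _ ?N] assoc_mult_mat[of _ ?N ?N _ ?N _ ?N])
  hence "transpose_mat (W * Q) * (W * Q) = 1\<^sub>m ?N"
    unfolding WtW using Q Qtc QtQ by simp
  ultimately show ?case using W Q F by (intro exI[of _ "W * Q"] exI[of _ F]) auto
qed

text \<open>Connects the eigenvalues, defined as roots with multiplicity, to the diagonal of
  \<open>D\<close>: similar matrices share their characteristic polynomial, and that of
  \<open>D\<close> is a product of linear factors.\<close>

lemma proots_char_poly_orthogonally_diagonal:
  fixes P D :: "real mat"
  assumes P: "P \<in> carrier_mat n n" and D: "D \<in> carrier_mat n n" and PtP: "transpose_mat P * P = 1\<^sub>m n"
    and diag: "diagonal_mat D"
  shows "proots (char_poly (P * D * transpose_mat P)) = mset (diag_mat D)"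
proof -
  have Pt: "transpose_mat P \<in> carrier_mat n n" using P by simp
  have "similar_mat (P * D * transpose_mat P) D"
    by (rule similar_matI[of _ _ P "transpose_mat P" n])
      (use P D PtP mat_mult_left_right_inverse[OF Pt P PtP] in auto)
  hence "char_poly (P * D * transpose_mat P) = char_poly D" by (rule char_poly_similar)
  also have "\<dots> = (\<Prod>a\<leftarrow>diag_mat D. [:- a, 1:])"
    by (rule char_poly_upper_triangular[OF D]) (use diag D in \<open>auto simp: diagonal_mat_def\<close>)
  also have "proots \<dots> = mset (diag_mat D)"
  proof (rule list.induct[where P = "\<lambda>as. proots (\<Prod>a\<leftarrow>as. [:- a, 1:]) = mset as"])
    fix a :: real and as :: "real list"
    assume IH: "proots (\<Prod>a\<leftarrow>as. [:- a, 1:]) = mset as"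
    have "(\<Prod>a\<leftarrow>as. [:- a, 1:]) \<noteq> 0" by (auto simp: prod_list_zero_iff)
    thus "proots (\<Prod>a\<leftarrow>a # as. [:- a, 1:]) = mset (a # as)"
      using IH by (simp add: proots_mult del: mult_pCons_left)
  qed simp
  finally show ?thesis .
qed

section \<open>Min-max bounds for the sorted eigenvalues\<close>

text \<open>Gaussian elimination: an equation that is zero on \<open>J\<close> is dropped, and any
  other one is solved for a pivot unknown \<open>l\<close>, which removes one equation and one
  unknown.\<close>

lemma exists_nontrivial_kernel:
  fixes a :: "'i \<Rightarrow> 'j \<Rightarrow> real"
  assumes "finite I" "finite J" "card I < card J"
  shows "\<exists>y. (\<exists>j\<in>J. y j \<noteq> 0) \<and> (\<forall>i\<in>I. (\<Sum>j\<in>J. a i j * y j) = 0)"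
  using assms
proof (induction I arbitrary: J a rule: finite_induct)
  case empty
  thus ?case by (intro exI[of _ "\<lambda>_. 1"]) (auto simp: card_gt_0_iff)
next
  case (insert k I)
  show ?case
  proof (cases "\<forall>j\<in>J. a k j = 0")
    case True
    have "card I < card J" using insert by simp
    from insert.IH[OF insert.prems(1) this] obtain y where "\<exists>j\<in>J. y j \<noteq> 0"
      "\<forall>i\<in>I. (\<Sum>j\<in>J. a i j * y j) = 0" by blast
    with True show ?thesis by (intro exI[of _ y]) auto
  next
    case False
    then obtain l where l: "l \<in> J" "a k l \<noteq> 0" by blast
    \<comment> \<open>Row \<open>i\<close> minus the multiple of row \<open>k\<close> that cancels
      the coefficient at \<open>l\<close>; row \<open>k\<close> itself becomes zero.\<close>
    define b where "b i j = a i j - a i l * a k j / a k l" for i j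
    have "card I < card (J - {l})" using insert l by simp
    moreover have "finite (J - {l})" using insert.prems by simp
    ultimately obtain y where y: "\<exists>j\<in>J-{l}. y j \<noteq> 0" "\<forall>i\<in>I. (\<Sum>j\<in>J-{l}. b i j * y j) = 0"
      using insert.IH[of "J - {l}" b] by blast
    \<comment> \<open>The pivot unknown receives the value \<open>- t / a k l\<close>, which makes
      equation \<open>k\<close> hold.\<close>
    define t where "t = (\<Sum>j\<in>J-{l}. a k j * y j)"
    define z where "z = y(l := - t / a k l)"
    have sumz: "(\<Sum>j\<in>J. a i j * z j) = (\<Sum>j\<in>J-{l}. a i j * y j) - a i l * t / a k l" for i
      unfolding z_def by (subst sum.remove[OF insert.prems(1) l(1)]) (simp add: algebra_simps)
    have "(\<Sum>j\<in>J. a i j * z j) = (\<Sum>j\<in>J-{l}. b i j * y j)" for i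
      unfolding sumz b_def t_def
      by (simp add: left_diff_distrib sum_subtractf sum_distrib_left sum_divide_distrib mult.assoc)
    hence "\<forall>i\<in>insert k I. (\<Sum>j\<in>J. a i j * z j) = 0"
      using y(2) l(2) by (auto simp: b_def)
    moreover have "\<exists>j\<in>J. z j \<noteq> 0" using y(1) unfolding z_def by auto
    ultimately show ?thesis by blast
  qed
qed

text \<open>Trades a bound on one entry of the sorted list for a count in the original order: the
  \<open>m + 1\<close> positions \<open>0..m\<close> of the sorted list lie below \<open>c\<close>,
  and sorting preserves the number of such entries.\<close>

lemma sorted_list_nth_less_card:
  fixes xs :: "real list"
  assumes "m < length xs" "sort xs ! m < c"
  shows "m < card {i. i < length xs \<and> xs ! i < c}"
proof -
  have "{0..m} \<subseteq> {i. i < length (sort xs) \<and> sort xs ! i < c}"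
    using assms sorted_nth_mono[OF sorted_sort, of _ m xs] by fastforce
  from card_mono[OF _ this] have "m < card {i. i < length (sort xs) \<and> sort xs ! i < c}" by simp
  also have "\<dots> = length (filter (\<lambda>x. x < c) (sort xs))" by (simp only: length_filter_conv_card)
  also have "\<dots> = size (filter_mset (\<lambda>x. x < c) (mset (sort xs)))" by (metis mset_filter size_mset)
  also have "\<dots> = length (filter (\<lambda>x. x < c) xs)" by (metis mset_filter mset_sort size_mset)
  also have "\<dots> = card {i. i < length xs \<and> xs ! i < c}" by (simp only: length_filter_conv_card)
  finally show ?thesis .
qed

lemma sorted_eigenvalues_diag:
  assumes "P \<in> carrier_mat n n" "D \<in> carrier_mat n n" "transpose_mat P * P = 1\<^sub>m n" "diagonal_mat D"
  shows "sorted_eigenvalues (P * D * transpose_mat P) = sort (diag_mat D)"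
  unfolding sorted_eigenvalues_def proots_char_poly_orthogonally_diagonal[OF assms] by simp

text \<open>The columns of \<open>P\<close> are orthonormal eigenvectors, so \<open>y\<close> lists
  coordinates in an eigenbasis.\<close>

lemma quadratic_form_diagonal:
  fixes P D :: "real mat"
  assumes P: "P \<in> carrier_mat n n" and D: "D \<in> carrier_mat n n" and PtP: "transpose_mat P * P = 1\<^sub>m n"
    and diag: "diagonal_mat D" and y: "y \<in> carrier_vec n"
  shows "(P *\<^sub>v y) \<bullet> ((P * D * transpose_mat P) *\<^sub>v (P *\<^sub>v y)) = (\<Sum>i<n. D $$ (i,i) * (y $ i)\<^sup>2)"
    and "(P *\<^sub>v y) \<bullet> (P *\<^sub>v y) = (\<Sum>i<n. (y $ i)\<^sup>2)"
proof -
  have Pt: "transpose_mat P \<in> carrier_mat n n" using P by simp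
  have Py: "P *\<^sub>v y \<in> carrier_vec n" using P y by simp
  have PtPy: "transpose_mat P *\<^sub>v (P *\<^sub>v y) = y"
    using assoc_mult_mat_vec[OF Pt P y] PtP y by simp
  have Dy: "D *\<^sub>v y \<in> carrier_vec n" using D y by simp
  have adj: "(P *\<^sub>v y) \<bullet> (P *\<^sub>v z) = y \<bullet> z" if "z \<in> carrier_vec n" for z
  proof -
    have "(P *\<^sub>v y) \<bullet> (P *\<^sub>v z) = y \<bullet> (transpose_mat P *\<^sub>v (P *\<^sub>v z))"
      using transpose_vec_mult_scalar[of "transpose_mat P" n n "P *\<^sub>v z" y] P that y by simp
    also have "transpose_mat P *\<^sub>v (P *\<^sub>v z) = z"
      using assoc_mult_mat_vec[OF Pt P that] PtP that by simp
    finally show ?thesis .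
  qed
  show "(P *\<^sub>v y) \<bullet> (P *\<^sub>v y) = (\<Sum>i<n. (y $ i)\<^sup>2)"
    unfolding adj[OF y] using y by (simp add: scalar_prod_def power2_eq_square lessThan_atLeast0)
  have "(P * D * transpose_mat P) *\<^sub>v (P *\<^sub>v y) = P *\<^sub>v (D *\<^sub>v y)"
    using P D Pt Py y Dy PtPy by (simp add: assoc_mult_mat_vec[of _ n n _ n])
  hence "(P *\<^sub>v y) \<bullet> ((P * D * transpose_mat P) *\<^sub>v (P *\<^sub>v y)) = y \<bullet> (D *\<^sub>v y)"
    using adj[OF Dy] by simp
  also have "\<dots> = (\<Sum>i<n. D $$ (i,i) * (y $ i)\<^sup>2)"
  proof -
    have "(D *\<^sub>v y) $ i = D $$ (i,i) * y $ i" if i: "i < n" for i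
    proof -
      have "(D *\<^sub>v y) $ i = (\<Sum>j\<in>{0..<n}. D $$ (i,j) * y $ j)"
        using i D y by (simp add: scalar_prod_def)
      also have "\<dots> = (\<Sum>j\<in>{0..<n}. if j = i then D $$ (i,i) * y $ i else 0)"
        using diag D i by (intro sum.cong) (auto simp: diagonal_mat_def)
      finally show ?thesis using i by simp
    qed
    thus ?thesis using D y by (simp add: scalar_prod_def power2_eq_square lessThan_atLeast0 algebra_simps)
  qed
  finally show "(P *\<^sub>v y) \<bullet> ((P * D * transpose_mat P) *\<^sub>v (P *\<^sub>v y)) = (\<Sum>i<n. D $$ (i,i) * (y $ i)\<^sup>2)" .
qed

text \<open>One half of the min-max principle. If the eigenvalue were below \<open>c\<close>, more
  than \<open>card I\<close> eigenvectors would belong to eigenvalues below \<open>c\<close>. Their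
  span then contains a nonzero vector satisfying all \<open>card I\<close> linear conditions, and
  there the form is too small.\<close>

lemma nth_eigenvalue_ge:
  fixes A :: "real mat"
  assumes A: "A \<in> carrier_mat n n" and sym: "transpose_mat A = A"
    and I: "finite I" "card I < n"
    and bound: "\<And>x. x \<in> carrier_vec n \<Longrightarrow> (\<And>i. i \<in> I \<Longrightarrow> (\<Sum>k<n. w i k * x $ k) = 0) \<Longrightarrow>
      c * (x \<bullet> x) \<le> x \<bullet> (A *\<^sub>v x)"
  shows "c \<le> nth_eigenvalue (card I + 1) A"
proof (rule ccontr)
  assume "\<not> ?thesis"
  hence less: "nth_eigenvalue (card I + 1) A < c" by simp
  obtain P D where P: "P \<in> carrier_mat n n" and D: "D \<in> carrier_mat n n"
    and PtP: "transpose_mat P * P = 1\<^sub>m n" and diag: "diagonal_mat D"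
    and AP: "A = P * D * transpose_mat P" using real_symmetric_diagonalization[OF A sym] by blast
  define J where "J = {j. j < n \<and> D $$ (j,j) < c}"
  have len: "length (diag_mat D) = n" using D by (simp add: diag_mat_def)
  have nth: "diag_mat D ! j = D $$ (j,j)" if "j < n" for j
    using D that by (simp add: diag_mat_def)
  have "sort (diag_mat D) ! card I < c"
    using less unfolding nth_eigenvalue_def AP sorted_eigenvalues_diag[OF P D PtP diag] by simp
  from sorted_list_nth_less_card[OF _ this] have "card I < card J"
    using I len unfolding J_def by (simp add: nth cong: conj_cong)
  moreover have J: "finite J" "J \<subseteq> {..<n}" unfolding J_def by auto
  ultimately obtain y where y0: "\<exists>j\<in>J. y j \<noteq> 0"
    and y: "\<forall>i\<in>I. (\<Sum>j\<in>J. (\<Sum>k<n. w i k * P $$ (k,j)) * y j) = 0"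
    using exists_nontrivial_kernel[OF I(1), of J "\<lambda>i j. \<Sum>k<n. w i k * P $$ (k,j)"] by blast
  \<comment> \<open>The solution \<open>y\<close> gives coordinates with respect to the eigenvectors
    in \<open>J\<close>; the other coordinates are zero.\<close>
  define z where "z = vec n (\<lambda>j. if j \<in> J then y j else 0)"
  have z: "z \<in> carrier_vec n" unfolding z_def by simp
  have sumz: "(\<Sum>j<n. f j (z $ j)) = (\<Sum>j\<in>J. f j (y j))" if "\<And>j. f j 0 = 0" for f :: "nat \<Rightarrow> real \<Rightarrow> real"
  proof -
    have "(\<Sum>j<n. f j (z $ j)) = (\<Sum>j<n. if j \<in> J then f j (y j) else 0)"
      by (intro sum.cong) (auto simp: z_def that)
    also have "\<dots> = (\<Sum>j\<in>{..<n} \<inter> J. f j (y j))" by (subst sum.inter_restrict) auto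
    finally show ?thesis using J by (simp add: Int_absorb1)
  qed
  have "(\<Sum>k<n. w i k * (P *\<^sub>v z) $ k) = 0" if i: "i \<in> I" for i
  proof -
    have "(\<Sum>k<n. w i k * (P *\<^sub>v z) $ k) = (\<Sum>k<n. w i k * (\<Sum>j<n. P $$ (k,j) * z $ j))"
      using P z by (intro sum.cong) (auto simp: scalar_prod_def lessThan_atLeast0)
    also have "\<dots> = (\<Sum>k<n. w i k * (\<Sum>j\<in>J. P $$ (k,j) * y j))"
      by (subst sumz) auto
    also have "\<dots> = (\<Sum>j\<in>J. (\<Sum>k<n. w i k * P $$ (k,j)) * y j)"
      by (simp add: sum_distrib_left sum_distrib_right mult.assoc) (rule sum.swap)
    finally show ?thesis using y i by simp
  qed
  hence "c * ((P *\<^sub>v z) \<bullet> (P *\<^sub>v z)) \<le> (P *\<^sub>v z) \<bullet> (A *\<^sub>v (P *\<^sub>v z))"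
    using bound[of "P *\<^sub>v z"] P z by simp
  hence "c * (\<Sum>j\<in>J. (y j)\<^sup>2) \<le> (\<Sum>j\<in>J. D $$ (j,j) * (y j)\<^sup>2)"
    unfolding AP quadratic_form_diagonal[OF P D PtP diag z]
    using sumz[of "\<lambda>j t. t\<^sup>2"] sumz[of "\<lambda>j t. D $$ (j,j) * t\<^sup>2"] by simp
  moreover have "(\<Sum>j\<in>J. D $$ (j,j) * (y j)\<^sup>2) < (\<Sum>j\<in>J. c * (y j)\<^sup>2)"
    using y0 by (intro sum_strict_mono_ex1 J ballI mult_right_mono) (auto simp: J_def)
  ultimately show False by (simp add: sum_distrib_left)
qed

text \<open>An eigenvalue is the value of the form at a unit eigenvector. This crude bound serves to
  show that the supremum over all \<open>p\<close> is taken over a bounded set.\<close>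

lemma nth_eigenvalue_le:
  fixes A :: "real mat"
  assumes A: "A \<in> carrier_mat n n" and sym: "transpose_mat A = A" and m: "m < n"
    and bound: "\<And>x. x \<in> carrier_vec n \<Longrightarrow> x \<bullet> x = 1 \<Longrightarrow> x \<bullet> (A *\<^sub>v x) \<le> c"
  shows "nth_eigenvalue (m + 1) A \<le> c"
proof -
  obtain P D where P: "P \<in> carrier_mat n n" and D: "D \<in> carrier_mat n n"
    and PtP: "transpose_mat P * P = 1\<^sub>m n" and diag: "diagonal_mat D"
    and AP: "A = P * D * transpose_mat P" using real_symmetric_diagonalization[OF A sym] by blast
  have len: "length (diag_mat D) = n" using D by (simp add: diag_mat_def)
  have "nth_eigenvalue (m + 1) A \<in> set (sort (diag_mat D))"
    unfolding nth_eigenvalue_def AP sorted_eigenvalues_diag[OF P D PtP diag]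
    using m len by (metis add_diff_cancel_right' length_sort nth_mem)
  then obtain i where i: "i < n" and ev: "nth_eigenvalue (m + 1) A = D $$ (i,i)"
    using D by (auto simp: diag_mat_def)
  have u: "unit_vec n i \<in> carrier_vec n" by simp
  have 1: "(\<Sum>j<n. f j * (unit_vec n i $ j)\<^sup>2) = f i" for f :: "nat \<Rightarrow> real"
  proof -
    have "(\<Sum>j<n. f j * (unit_vec n i $ j)\<^sup>2) = (\<Sum>j<n. if j = i then f i else 0)"
      using i by (intro sum.cong) auto
    thus ?thesis using i by simp
  qed
  note q = quadratic_form_diagonal[OF P D PtP diag u]
  have "(P *\<^sub>v unit_vec n i) \<bullet> (P *\<^sub>v unit_vec n i) = 1" using q(2) 1[of "\<lambda>_. 1"] by simp
  from bound[OF _ this] have "(P *\<^sub>v unit_vec n i) \<bullet> (A *\<^sub>v (P *\<^sub>v unit_vec n i)) \<le> c" using P by simp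
  thus ?thesis unfolding ev unfolding AP q(1) 1 .
qed

section \<open>Rigidity of the cross-polytope\<close>

text \<open>The index \<open>u < 2d\<close> stands for \<open>e\<^sub>u\<close> if \<open>u < d\<close> and for \<open>-e\<^bsub>u-d\<^esub>\<close> otherwise;
  \<open>cross_form d u w z\<close> is the inner product of \<open>z\<close> with the unit vector from vertex \<open>w\<close> to
  vertex \<open>u\<close>.\<close>

definition axis_sign :: "nat \<Rightarrow> nat \<Rightarrow> real" where
  "axis_sign d u = (if u < d then 1 else - 1)"

definition cross_form :: "nat \<Rightarrow> nat \<Rightarrow> nat \<Rightarrow> (nat \<Rightarrow> real) \<Rightarrow> real" where
  "cross_form d u w z =
    (if u = w then 0
     else if u mod d = w mod d then axis_sign d u * z (u mod d)
     else (axis_sign d u * z (u mod d) - axis_sign d w * z (w mod d)) / sqrt 2)"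

lemma axis_sign_square [simp]: "(axis_sign d u)\<^sup>2 = 1"
  by (simp add: axis_sign_def)

lemma cross_form_add: "cross_form d u w (\<lambda>c. y c + z c) = cross_form d u w y + cross_form d u w z"
  by (simp add: cross_form_def algebra_simps add_divide_distrib diff_divide_distrib)

lemma cross_form_diff: "cross_form d u w (\<lambda>c. y c - z c) = cross_form d u w y - cross_form d u w z"
  by (simp add: cross_form_def algebra_simps add_divide_distrib diff_divide_distrib)

lemma cross_form_sum:
  "cross_form d u w (\<lambda>c. \<Sum>v\<in>V. y v c) = (\<Sum>v\<in>V. cross_form d u w (y v))"
  by (simp add: cross_form_def sum_distrib_left sum_subtractf sum_divide_distrib diff_divide_distrib)

lemma cross_form_commute_square: "(cross_form d u w z)\<^sup>2 = (cross_form d w u z)\<^sup>2"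
proof -
  have "(axis_sign d u * s - axis_sign d w * t)\<^sup>2 = (axis_sign d w * t - axis_sign d u * s)\<^sup>2" for s t
    by (rule power2_commute)
  thus ?thesis by (simp add: cross_form_def power_mult_distrib power_divide)
qed

text \<open>Sorts the vertices of the cross-polytope into antipodal pairs.\<close>

lemma sum_lessThan_double: "(\<Sum>u<2*d. f u) = (\<Sum>i<d. f i + f (d + i) :: real)" for d :: nat
proof -
  have "(\<Sum>u<d+m. f u) = (\<Sum>i<d. f i) + (\<Sum>i<m. f (d + i))" for m
    by (induction m) (simp_all add: add.assoc)
  from this[of d] show ?thesis by (simp add: mult_2 sum.distrib)
qed

text \<open>The vertices \<open>j\<close> and \<open>d + j\<close> together account for
  \<open>(z j)\<^sup>2\<close>. On the axis of \<open>u\<close>, this comes from the antipode of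
  \<open>u\<close> alone. On any other axis, the two directions form an orthonormal basis of the
  plane spanned by both axes.\<close>

lemma sum_square_cross_form_ge:
  assumes u: "u < 2 * d"
  shows "(\<Sum>c<d. (z c)\<^sup>2) \<le> (\<Sum>w<2*d. (cross_form d u w z)\<^sup>2)"
  unfolding sum_lessThan_double
proof (rule sum_mono)
  fix j assume "j \<in> {..<d}"
  hence j: "j < d" by simp
  define s where "s = axis_sign d u"
  have s: "s\<^sup>2 = 1" unfolding s_def by simp
  show "(z j)\<^sup>2 \<le> (cross_form d u j z)\<^sup>2 + (cross_form d u (d + j) z)\<^sup>2"
  proof (cases "u mod d = j")
    case True
    hence "u = j \<or> u = d + j" using u j
      by (cases "u < d") (auto simp: mod_if split: if_splits)
    thus ?thesis using True j by (auto simp: cross_form_def power_mult_distrib)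
  next
    case False
    hence ne: "u \<noteq> j" "u \<noteq> d + j" using j by auto
    have "(cross_form d u j z)\<^sup>2 + (cross_form d u (d + j) z)\<^sup>2 =
        (s * z (u mod d) - z j)\<^sup>2 / 2 + (s * z (u mod d) + z j)\<^sup>2 / 2"
      using ne False j by (simp add: cross_form_def power_divide axis_sign_def[of d j] axis_sign_def[of d "d + j"] s_def)
    also have "\<dots> = (z (u mod d))\<^sup>2 + (z j)\<^sup>2"
      using s by (simp add: power2_sum power2_diff power_mult_distrib field_simps)
    finally show ?thesis by simp
  qed
qed

lemma cross_polytope_rigidity:
  fixes X :: "nat \<Rightarrow> nat \<Rightarrow> real"
  assumes translation: "\<And>i. i < d \<Longrightarrow> (\<Sum>u<2*d. X u i) = 0"
    and rotation: "\<And>i j. i < j \<Longrightarrow> j < d \<Longrightarrow> X i j - X (d + i) j = X j i - X (d + j) i"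
  shows "2 * (\<Sum>u<2*d. \<Sum>c<d. (X u c)\<^sup>2) \<le>
    (\<Sum>u<2*d. \<Sum>w<2*d. (cross_form d u w (\<lambda>c. X u c - X w c))\<^sup>2)"
proof -
  \<comment> \<open>In the even parts \<open>a\<close> and odd parts \<open>b\<close>, the form splits into stars, on which the translation
    condition acts, and the sums \<open>b i j + b j i\<close>, controlled by the rotation condition.\<close>
  define a where "a i j = (X i j + X (d + i) j) / 2" for i j
  define b where "b i j = (X i j - X (d + i) j) / 2" for i j
  have X: "X i j = a i j + b i j" "X (d + i) j = a i j - b i j" for i j
    by (simp_all add: a_def b_def field_simps)
  \<comment> \<open>The rotation condition says that \<open>b\<close> is symmetric, whereas an
    infinitesimal rotation would make it skew-symmetric.\<close>
  have bsym: "b i j = b j i" if "i < d" "j < d" for i j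
    using that rotation[of i j] rotation[of j i] unfolding b_def by (cases i j rule: linorder_cases) auto
  have suma: "(\<Sum>j<d. a j i) = 0" if "i < d" for i
    using translation[OF that] unfolding sum_lessThan_double a_def
    by (simp flip: sum_divide_distrib)
  \<comment> \<open>The contribution of the four ordered pairs that join the axis \<open>i\<close>
    to the axis \<open>j\<close>.\<close>
  define T where "T i j = (cross_form d i j (\<lambda>c. X i c - X j c))\<^sup>2
    + (cross_form d i (d + j) (\<lambda>c. X i c - X (d + j) c))\<^sup>2
    + (cross_form d (d + i) j (\<lambda>c. X (d + i) c - X j c))\<^sup>2
    + (cross_form d (d + i) (d + j) (\<lambda>c. X (d + i) c - X (d + j) c))\<^sup>2" for i j
  have T: "2 * (a i i - a j i)\<^sup>2 + 2 * (a j j - a i j)\<^sup>2 + 8 * (b i j)\<^sup>2 \<le> T i j"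
    if i: "i < d" and j: "j < d" for i j
  proof (cases "i = j")
    case True
    have "T i i = 8 * (b i i)\<^sup>2"
      unfolding T_def X(2) unfolding X(1) cross_form_def axis_sign_def using i
      by (simp add: power2_eq_square algebra_simps)
    thus ?thesis using True by simp
  next
    case False
    \<comment> \<open>Between distinct axes the square of \<open>b i i + b j j\<close> can be
      discarded, since the diagonal entries of \<open>b\<close> are already controlled by the
      antipodal pairs, the case \<open>i = j\<close>.\<close>
    have "T i j = 2 * ((b i i + b j j)\<^sup>2 + (a i i - a j i)\<^sup>2 + (a j j - a i j)\<^sup>2 + (b i j + b j i)\<^sup>2)"
      unfolding T_def X(2) unfolding X(1) cross_form_def axis_sign_def using i j False
      by (simp add: power_divide power2_eq_square field_simps)
    moreover have "(b i j + b j i)\<^sup>2 = 4 * (b i j)\<^sup>2"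
      unfolding bsym[OF j i] by (simp add: power2_eq_square)
    ultimately show ?thesis by simp
  qed
  \<comment> \<open>Expanding the squares, the mixed term vanishes by the translation condition, and
    \<open>real d * (a i i)\<^sup>2\<close> remains as a surplus.\<close>
  have star: "(\<Sum>j<d. (a j i)\<^sup>2) \<le> (\<Sum>j<d. (a i i - a j i)\<^sup>2)" if "i < d" for i
  proof -
    have "(\<Sum>j<d. (a i i - a j i)\<^sup>2) = real d * (a i i)\<^sup>2 - 2 * a i i * (\<Sum>j<d. a j i) + (\<Sum>j<d. (a j i)\<^sup>2)"
      by (simp add: power2_diff sum.distrib sum_subtractf sum_distrib_left mult_ac)
    thus ?thesis using suma[OF that] by simp
  qed
  have "2 * (\<Sum>u<2*d. \<Sum>c<d. (X u c)\<^sup>2) = 4 * (\<Sum>i<d. \<Sum>j<d. (a i j)\<^sup>2) + 4 * (\<Sum>i<d. \<Sum>j<d. (b i j)\<^sup>2)"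
    unfolding sum_lessThan_double X(2) unfolding X(1)
    by (simp add: power2_sum power2_diff sum.distrib sum_subtractf algebra_simps flip: sum_distrib_left)
  also have "\<dots> \<le> 4 * (\<Sum>i<d. \<Sum>j<d. (a j i)\<^sup>2) + 8 * (\<Sum>i<d. \<Sum>j<d. (b i j)\<^sup>2)"
    by (subst sum.swap) (auto intro!: add_mono mult_right_mono sum_nonneg)
  also have "\<dots> \<le> 4 * (\<Sum>i<d. \<Sum>j<d. (a i i - a j i)\<^sup>2) + 8 * (\<Sum>i<d. \<Sum>j<d. (b i j)\<^sup>2)"
    by (intro add_right_mono mult_left_mono sum_mono[OF star]) auto
  \<comment> \<open>One half of the star sum is rewritten with \<open>i\<close> and \<open>j\<close>
    exchanged, to match the two star terms in the lower bound for \<open>T i j\<close>.\<close>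
  also have "\<dots> = 2 * (\<Sum>i<d. \<Sum>j<d. (a i i - a j i)\<^sup>2) + 2 * (\<Sum>i<d. \<Sum>j<d. (a j j - a i j)\<^sup>2)
      + 8 * (\<Sum>i<d. \<Sum>j<d. (b i j)\<^sup>2)"
    by (subst (3) sum.swap) simp
  also have "\<dots> = (\<Sum>i<d. \<Sum>j<d. 2 * (a i i - a j i)\<^sup>2 + 2 * (a j j - a i j)\<^sup>2 + 8 * (b i j)\<^sup>2)"
    by (simp add: sum.distrib sum_distrib_left)
  also have "\<dots> \<le> (\<Sum>i<d. \<Sum>j<d. T i j)" by (intro sum_mono T) auto
  also have "\<dots> = (\<Sum>u<2*d. \<Sum>w<2*d. (cross_form d u w (\<lambda>c. X u c - X w c))\<^sup>2)"
    unfolding sum_lessThan_double T_def by (simp add: sum.distrib)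
  finally show ?thesis .
qed

section \<open>Blowing up the vertices of the cross-polytope into classes\<close>

text \<open>All mixed terms contain the factor of a vanishing sum. This is what decouples class
  means from deviations.\<close>

lemma sum_square_differences_centered:
  fixes f :: "'a \<Rightarrow> real" and g :: "'b \<Rightarrow> real"
  assumes "(\<Sum>v\<in>V. f v) = 0" "(\<Sum>w\<in>W. g w) = 0"
  shows "(\<Sum>v\<in>V. \<Sum>w\<in>W. (t + f v - g w)\<^sup>2) =
    real (card V) * real (card W) * t\<^sup>2 + real (card W) * (\<Sum>v\<in>V. (f v)\<^sup>2)
      + real (card V) * (\<Sum>w\<in>W. (g w)\<^sup>2)"
proof -
  have "(\<Sum>w\<in>W. (t + f v - g w)\<^sup>2) = real (card W) * (t + f v)\<^sup>2 + (\<Sum>w\<in>W. (g w)\<^sup>2)" for v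
    using assms(2) by (simp add: power2_diff sum.distrib sum_subtractf flip: sum_distrib_left)
  moreover have "(\<Sum>v\<in>V. (t + f v)\<^sup>2) = real (card V) * t\<^sup>2 + (\<Sum>v\<in>V. (f v)\<^sup>2)"
    using assms(1) by (simp add: power2_sum sum.distrib flip: sum_distrib_left)
  ultimately show ?thesis
    by (simp add: sum.distrib algebra_simps flip: sum_distrib_left)
qed

text \<open>Each \<open>x v\<close> is its class mean \<open>X (g v)\<close> plus a deviation. The
  means carry weight at most \<open>M\<close> in the norm but at least \<open>k * k\<close> in the
  form, whence \<open>\<kappa> * real M \<le> (real k)\<^sup>2\<close>; the deviations gain a factor
  \<open>k\<close>, whence \<open>\<kappa> \<le> real k\<close>. The factor 2 reflects that the form
  counts ordered pairs.\<close>

lemma blown_up_cross_polytope_rigidity: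
  fixes x X :: "nat \<Rightarrow> nat \<Rightarrow> real" and g :: "nat \<Rightarrow> nat" and k M :: nat
  assumes g: "\<And>v. v < n \<Longrightarrow> g v < 2 * d"
    and lower: "\<And>u. u < 2 * d \<Longrightarrow> k \<le> card {v\<in>{..<n}. g v = u}"
    and upper: "\<And>u. u < 2 * d \<Longrightarrow> card {v\<in>{..<n}. g v = u} \<le> M"
    and mean: "\<And>u c. u < 2 * d \<Longrightarrow> c < d \<Longrightarrow>
      real (card {v\<in>{..<n}. g v = u}) * X u c = (\<Sum>v | v \<in> {..<n} \<and> g v = u. x v c)"
    and translation: "\<And>i. i < d \<Longrightarrow> (\<Sum>u<2*d. X u i) = 0"
    and rotation: "\<And>i j. i < j \<Longrightarrow> j < d \<Longrightarrow> X i j - X (d + i) j = X j i - X (d + j) i"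
    and \<kappa>: "0 \<le> \<kappa>" "\<kappa> \<le> real k" "\<kappa> * real M \<le> (real k)\<^sup>2"
  shows "2 * \<kappa> * (\<Sum>v<n. \<Sum>c<d. (x v c)\<^sup>2) \<le>
    (\<Sum>v<n. \<Sum>w<n. (cross_form d (g v) (g w) (\<lambda>c. x v c - x w c))\<^sup>2)"
proof -
  define V where "V u = {v\<in>{..<n}. g v = u}" for u
  define y where "y v c = x v c - X (g v) c" for v c
  note lower = lower[folded V_def] and upper = upper[folded V_def]
  have group: "(\<Sum>v<n. h v) = (\<Sum>u<2*d. \<Sum>v\<in>V u. h v)" for h :: "nat \<Rightarrow> real"
    unfolding V_def by (rule sum.group[symmetric]) (use g in auto)
  have gV: "g v = u" if "v \<in> V u" for u v using that unfolding V_def by simp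
  have ysum: "(\<Sum>v\<in>V u. y v c) = 0" if "u < 2 * d" "c < d" for u c
  proof -
    have "(\<Sum>v\<in>V u. y v c) = (\<Sum>v\<in>V u. x v c - X u c)"
      by (intro sum.cong) (auto simp: y_def gV)
    thus ?thesis using mean[OF that] unfolding V_def by (simp add: sum_subtractf)
  qed
  have ycf: "(\<Sum>v\<in>V r. cross_form d u w (y v)) = 0" if "u < 2 * d" "r < 2 * d" for u w r
  proof -
    have d: "d > 0" using that by simp
    show ?thesis unfolding cross_form_sum[symmetric] using that ysum
      by (simp add: cross_form_def d)
  qed
  let ?SX = "\<Sum>u<2*d. \<Sum>c<d. (X u c)\<^sup>2"
  let ?SY = "\<Sum>u<2*d. \<Sum>v\<in>V u. \<Sum>c<d. (y v c)\<^sup>2"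
  have "(\<Sum>v<n. \<Sum>c<d. (x v c)\<^sup>2) = (\<Sum>u<2*d. (\<Sum>c<d. real (card (V u)) * (X u c)\<^sup>2) + (\<Sum>v\<in>V u. \<Sum>c<d. (y v c)\<^sup>2))"
    unfolding group
  proof (rule sum.cong[OF refl])
    fix u assume "u \<in> {..<2*d}"
    hence u: "u < 2 * d" by simp
    have "(\<Sum>v\<in>V u. (x v c)\<^sup>2) = real (card (V u)) * (X u c)\<^sup>2 + (\<Sum>v\<in>V u. (y v c)\<^sup>2)" if c: "c < d" for c
    proof -
      have "(\<Sum>v\<in>V u. (x v c)\<^sup>2) = (\<Sum>v\<in>V u. (X u c + y v c)\<^sup>2)"
        by (intro sum.cong) (auto simp: y_def gV)
      thus ?thesis using ysum[OF u c]
        by (simp add: power2_sum sum.distrib flip: sum_distrib_left)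
    qed
    thus "(\<Sum>v\<in>V u. \<Sum>c<d. (x v c)\<^sup>2) =
        (\<Sum>c<d. real (card (V u)) * (X u c)\<^sup>2) + (\<Sum>v\<in>V u. \<Sum>c<d. (y v c)\<^sup>2)"
      by (subst (1 2) sum.swap[of _ "{..<d}"]) (simp add: sum.distrib)
  qed
  also have "\<dots> \<le> real M * ?SX + ?SY"
    unfolding sum.distrib sum_distrib_left
    by (intro add_mono sum_mono mult_right_mono order_refl) (use upper in auto)
  finally have "\<kappa> * (\<Sum>v<n. \<Sum>c<d. (x v c)\<^sup>2) \<le> \<kappa> * (real M * ?SX + ?SY)"
    using \<kappa>(1) by (rule mult_left_mono)
  also have "\<dots> = (\<kappa> * real M) * ?SX + \<kappa> * ?SY" by (simp add: algebra_simps)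
  also have "\<dots> \<le> (real k)\<^sup>2 * ?SX + real k * ?SY"
    using \<kappa> by (intro add_mono mult_right_mono sum_nonneg) auto
  finally have norm: "2 * \<kappa> * (\<Sum>v<n. \<Sum>c<d. (x v c)\<^sup>2) \<le> (real k)\<^sup>2 * (2 * ?SX) + 2 * (real k * ?SY)"
    by simp
  define F where "F u w = (cross_form d u w (\<lambda>c. X u c - X w c))\<^sup>2" for u w
  define G where "G u w = (\<Sum>v\<in>V u. (cross_form d u w (y v))\<^sup>2)" for u w
  \<comment> \<open>On the block of two classes the direction is constant, so the centered identity
    applies; \<open>G u w\<close> and \<open>G w u\<close> are the deviations in either
    class.\<close>
  have pair: "(real k)\<^sup>2 * F u w + real k * G u w + real k * G w u \<le>
      (\<Sum>v\<in>V u. \<Sum>v'\<in>V w. (cross_form d (g v) (g v') (\<lambda>c. x v c - x v' c))\<^sup>2)"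
    if u: "u < 2 * d" and w: "w < 2 * d" for u w
  proof -
    let ?t = "cross_form d u w (\<lambda>c. X u c - X w c)"
    have "(\<Sum>v\<in>V u. \<Sum>v'\<in>V w. (cross_form d (g v) (g v') (\<lambda>c. x v c - x v' c))\<^sup>2) =
        (\<Sum>v\<in>V u. \<Sum>v'\<in>V w. (?t + cross_form d u w (y v) - cross_form d u w (y v'))\<^sup>2)"
    proof (intro sum.cong refl)
      fix v v' assume v: "v \<in> V u" and v': "v' \<in> V w"
      have "?t + cross_form d u w (y v) - cross_form d u w (y v') =
          cross_form d u w (\<lambda>c. ((X u c - X w c) + y v c) - y v' c)"
        by (simp only: cross_form_add cross_form_diff)
      also have "(\<lambda>c. ((X u c - X w c) + y v c) - y v' c) = (\<lambda>c. x v c - x v' c)"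
        using v v' by (auto simp: y_def gV)
      finally show "(cross_form d (g v) (g v') (\<lambda>c. x v c - x v' c))\<^sup>2 =
          (?t + cross_form d u w (y v) - cross_form d u w (y v'))\<^sup>2"
        using v v' by (simp add: gV)
    qed
    also have "\<dots> = real (card (V u)) * real (card (V w)) * ?t\<^sup>2
        + real (card (V w)) * (\<Sum>v\<in>V u. (cross_form d u w (y v))\<^sup>2)
        + real (card (V u)) * (\<Sum>v'\<in>V w. (cross_form d u w (y v'))\<^sup>2)"
      by (rule sum_square_differences_centered) (use ycf u w in auto)
    also have "(\<Sum>v'\<in>V w. (cross_form d u w (y v'))\<^sup>2) = G w u"
      unfolding G_def by (simp add: cross_form_commute_square[of d u w])
    finally have eq: "(\<Sum>v\<in>V u. \<Sum>v'\<in>V w. (cross_form d (g v) (g v') (\<lambda>c. x v c - x v' c))\<^sup>2) =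
        real (card (V u)) * real (card (V w)) * F u w + real (card (V w)) * G u w + real (card (V u)) * G w u"
      unfolding F_def G_def .
    have "(real k)\<^sup>2 \<le> real (card (V u)) * real (card (V w))"
      unfolding power2_eq_square using lower[OF u] lower[OF w] by (intro mult_mono) auto
    moreover have "F u w \<ge> 0" "G u w \<ge> 0" "G w u \<ge> 0"
      unfolding F_def G_def by (auto intro: sum_nonneg)
    ultimately show ?thesis unfolding eq
      using lower[OF u] lower[OF w] by (intro add_mono mult_right_mono) auto
  qed
  have "2 * ?SX \<le> (\<Sum>u<2*d. \<Sum>w<2*d. F u w)"
    unfolding F_def by (rule cross_polytope_rigidity[OF translation rotation])
  moreover have "?SY \<le> (\<Sum>u<2*d. \<Sum>w<2*d. G u w)"
  proof (rule sum_mono)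
    fix u assume "u \<in> {..<2*d}"
    \<comment> \<open>For each single vertex, the directions from its class to all the others
      already dominate the norm of its deviation.\<close>
    thus "(\<Sum>v\<in>V u. \<Sum>c<d. (y v c)\<^sup>2) \<le> (\<Sum>w<2*d. G u w)"
      unfolding G_def by (subst sum.swap) (auto intro!: sum_mono sum_square_cross_form_ge)
  qed
  ultimately have "(real k)\<^sup>2 * (2 * ?SX) + 2 * (real k * ?SY) \<le>
      (real k)\<^sup>2 * (\<Sum>u<2*d. \<Sum>w<2*d. F u w) + 2 * (real k * (\<Sum>u<2*d. \<Sum>w<2*d. G u w))"
    by (intro add_mono mult_left_mono) auto
  also have "\<dots> = (\<Sum>u<2*d. \<Sum>w<2*d. (real k)\<^sup>2 * F u w + real k * G u w + real k * G w u)"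
  proof -
    have "(\<Sum>u<2*d. \<Sum>w<2*d. G u w) = (\<Sum>u<2*d. \<Sum>w<2*d. G w u)" by (rule sum.swap)
    thus ?thesis by (simp add: sum.distrib flip: sum_distrib_left)
  qed
  also have "\<dots> \<le> (\<Sum>u<2*d. \<Sum>w<2*d. \<Sum>v\<in>V u. \<Sum>v'\<in>V w. (cross_form d (g v) (g v') (\<lambda>c. x v c - x v' c))\<^sup>2)"
    by (intro sum_mono pair) auto
  also have "\<dots> = (\<Sum>u<2*d. \<Sum>v\<in>V u. \<Sum>w<2*d. \<Sum>v'\<in>V w. (cross_form d (g v) (g v') (\<lambda>c. x v c - x v' c))\<^sup>2)"
    by (intro sum.cong refl sum.swap)
  also have "\<dots> = (\<Sum>v<n. \<Sum>w<n. (cross_form d (g v) (g w) (\<lambda>c. x v c - x w c))\<^sup>2)"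
    unfolding group ..
  finally show ?thesis using norm by linarith
qed

section \<open>The stiffness form\<close>

text \<open>In the ordering fixed by \<open>kronecker_vec\<close>, coordinate \<open>j\<close> of
  vertex \<open>v\<close> stands at position \<open>v * d + j\<close>.\<close>

lemma sum_lessThan_mult:
  "(\<Sum>k<d*n. f k) = (\<Sum>v<n. \<Sum>j<d. f (v * d + j))" for n d :: nat
proof -
  have "(\<Sum>k<d*n. f k) = (\<Sum>v<n. sum f {v*d..<v*d + d})"
    by (simp add: sum.nat_group mult.commute[of d n])
  also have "\<dots> = (\<Sum>v<n. \<Sum>j<d. f (v * d + j))"
    by (intro sum.cong[OF refl], subst sum.atLeastLessThan_shift_0) (simp add: lessThan_atLeast0)
  finally show ?thesis .
qed

lemma rigidity_matrix_carrier: "rigidity_matrix d n E p \<in> carrier_mat (d * n) (length (edge_list n E))"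
  unfolding rigidity_matrix_def by (intro carrier_matI) simp_all

lemma stiffness_matrix_carrier: "stiffness_matrix d n E p \<in> carrier_mat (d * n) (d * n)"
  unfolding stiffness_matrix_def using rigidity_matrix_carrier[of d n E p] by simp

lemma stiffness_matrix_symmetric: "transpose_mat (stiffness_matrix d n E p) = stiffness_matrix d n E p"
  unfolding stiffness_matrix_def using rigidity_matrix_carrier[of d n E p]
  by (simp add: transpose_mult[of _ "d * n" "length (edge_list n E)" _ "d * n"])

lemma unit_direction_carrier:
  assumes "p v \<in> carrier_vec d"
  shows "unit_direction d p u v \<in> carrier_vec d"
  using assms by (intro carrier_vecI) (auto simp: unit_direction_def)

lemma kronecker_direction_carrier:
  assumes "p v \<in> carrier_vec d"
  shows "kronecker_vec (unit_vec n u - unit_vec n v) (unit_direction d p u v) \<in> carrier_vec (d * n)"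
  using unit_direction_carrier[of p v d u] assms by (simp add: kronecker_vec_def mult.commute)

lemma edge_list_bounds: "(u, v) \<in> set (edge_list n E) \<Longrightarrow> u < v \<and> v < n"
  by (auto simp: edge_list_def)

lemma stiffness_quadratic_form:
  assumes p: "p \<in> {0..<n} \<rightarrow> carrier_vec d" and x: "x \<in> carrier_vec (d * n)"
  shows "x \<bullet> (stiffness_matrix d n E p *\<^sub>v x) =
    (\<Sum>(u, v)\<leftarrow>edge_list n E.
      (kronecker_vec (unit_vec n u - unit_vec n v) (unit_direction d p u v) \<bullet> x)\<^sup>2)"
proof -
  let ?R = "rigidity_matrix d n E p"
  let ?m = "length (edge_list n E)"
  let ?c = "\<lambda>(u, v). kronecker_vec (unit_vec n u - unit_vec n v) (unit_direction d p u v)"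
  note R = rigidity_matrix_carrier[of d n E p]
  have Rt: "transpose_mat ?R \<in> carrier_mat ?m (d * n)" using R by simp
  have y: "transpose_mat ?R *\<^sub>v x \<in> carrier_vec ?m" using Rt x by simp
  have col: "col ?R i = ?c (edge_list n E ! i)" if i: "i < ?m" for i
  proof -
    have "edge_list n E ! i \<in> set (edge_list n E)" using i by simp
    moreover obtain u v where uv: "edge_list n E ! i = (u, v)" by fastforce
    ultimately have "v < n" using edge_list_bounds by metis
    hence "p v \<in> carrier_vec d" using p by auto
    hence "?c (edge_list n E ! i) \<in> carrier_vec (d * n)"
      unfolding uv using kronecker_direction_carrier by simp
    thus ?thesis unfolding rigidity_matrix_def using i by (subst col_mat_of_cols) auto
  qed
  have "x \<bullet> (stiffness_matrix d n E p *\<^sub>v x) = x \<bullet> (?R *\<^sub>v (transpose_mat ?R *\<^sub>v x))"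
    unfolding stiffness_matrix_def by (simp add: assoc_mult_mat_vec[OF R Rt x])
  also have "\<dots> = (transpose_mat ?R *\<^sub>v x) \<bullet> (transpose_mat ?R *\<^sub>v x)"
    using transpose_vec_mult_scalar[OF R y x] by simp
  also have "\<dots> = (\<Sum>i<?m. (col ?R i \<bullet> x)\<^sup>2)"
    using R by (simp add: scalar_prod_def[of "transpose_mat ?R *\<^sub>v x"] power2_eq_square lessThan_atLeast0)
  also have "\<dots> = (\<Sum>i<?m. (?c (edge_list n E ! i) \<bullet> x)\<^sup>2)" by (intro sum.cong) (auto simp: col)
  also have "\<dots> = (\<Sum>e\<leftarrow>edge_list n E. (?c e \<bullet> x)\<^sup>2)"
    by (simp add: sum_list_sum_nth lessThan_atLeast0)
  finally show ?thesis by (simp add: case_prod_unfold)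
qed

lemma kronecker_direction_scalar_prod:
  assumes "p v \<in> carrier_vec d" and x: "x \<in> carrier_vec (d * n)" and uv: "u < n" "v < n"
  shows "kronecker_vec (unit_vec n u - unit_vec n v) (unit_direction d p u v) \<bullet> x =
    (\<Sum>j<d. unit_direction d p u v $ j * (x $ (u * d + j) - x $ (v * d + j)))"
proof -
  let ?D = "unit_direction d p u v"
  have pick: "(\<Sum>i<n. of_bool (i = w) * h i) = h w" if "w < n" for w and h :: "nat \<Rightarrow> real"
    by (subst sum.remove[of _ w]) (use that in auto)
  have D: "dim_vec ?D = d" using unit_direction_carrier assms(1) by auto
  have "kronecker_vec (unit_vec n u - unit_vec n v) ?D \<bullet> x =
      (\<Sum>k<d*n. (unit_vec n u - unit_vec n v) $ (k div d) * ?D $ (k mod d) * x $ k)"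
    unfolding scalar_prod_def lessThan_atLeast0
    using x D by (intro sum.cong) (simp_all add: kronecker_vec_def mult.commute[of n d])
  also have "\<dots> = (\<Sum>i<n. \<Sum>j<d. (of_bool (i = u) - of_bool (i = v)) * (?D $ j * x $ (i * d + j)))"
    unfolding sum_lessThan_mult using uv by (intro sum.cong refl) simp
  also have "\<dots> = (\<Sum>i<n. of_bool (i = u) * (\<Sum>j<d. ?D $ j * x $ (i * d + j)))
      - (\<Sum>i<n. of_bool (i = v) * (\<Sum>j<d. ?D $ j * x $ (i * d + j)))"
    by (simp add: left_diff_distrib sum_subtractf sum_distrib_left)
  also have "\<dots> = (\<Sum>j<d. ?D $ j * x $ (u * d + j)) - (\<Sum>j<d. ?D $ j * x $ (v * d + j))"
    using uv by (simp only: pick)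
  finally show ?thesis by (simp add: sum_subtractf right_diff_distrib)
qed

lemma abs_unit_direction_le_1:
  assumes "p v \<in> carrier_vec d" "j < d"
  shows "\<bar>unit_direction d p u v $ j\<bar> \<le> 1"
proof (cases "p u = p v")
  case True
  thus ?thesis using assms by (simp add: unit_direction_def)
next
  case False
  let ?z = "p u - p v"
  have "dim_vec ?z = d" using assms by auto
  hence "(?z $ j)\<^sup>2 \<le> ?z \<bullet> ?z"
    unfolding scalar_prod_def power2_eq_square using assms(2)
    by (intro member_le_sum) auto
  hence "\<bar>?z $ j\<bar> \<le> eucl_norm ?z"
    unfolding eucl_norm_def by (rule real_le_rsqrt[of "\<bar>_\<bar>", simplified])
  moreover have "unit_direction d p u v $ j = ?z $ j / eucl_norm ?z"
    using False assms by (simp add: unit_direction_def)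
  moreover have "eucl_norm ?z \<ge> 0"
    unfolding eucl_norm_def scalar_prod_def by (auto intro: sum_nonneg)
  ultimately show ?thesis by (auto simp: divide_le_eq_1)
qed

text \<open>A real supremum dominates the members of its set only once boundedness is known.
  Directions have entries of absolute value at most 1, which bounds the form on unit vectors
  uniformly in \<open>p\<close>.\<close>

lemma bdd_above_nth_eigenvalue_stiffness:
  assumes m: "m < d * n"
  shows "bdd_above ((\<lambda>p. nth_eigenvalue (m + 1) (stiffness_matrix d n E p)) ` ({0..<n} \<rightarrow> carrier_vec d))"
proof (rule bdd_aboveI2)
  fix p :: "nat \<Rightarrow> real vec" assume p: "p \<in> {0..<n} \<rightarrow> carrier_vec d"
  \<comment> \<open>Per edge there are \<open>d\<close> terms, each at most 1 times the difference
    of two entries of a unit vector, hence at most 2.\<close>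
  let ?C = "(\<Sum>e\<leftarrow>edge_list n E. (2 * real d)\<^sup>2)"
  show "nth_eigenvalue (m + 1) (stiffness_matrix d n E p) \<le> ?C"
  proof (rule nth_eigenvalue_le[OF stiffness_matrix_carrier stiffness_matrix_symmetric m])
    fix x :: "real vec" assume x: "x \<in> carrier_vec (d * n)" and x1: "x \<bullet> x = 1"
    have x_le: "\<bar>x $ k\<bar> \<le> 1" if "k < d * n" for k
    proof -
      have "x $ k * x $ k \<le> x \<bullet> x"
        unfolding scalar_prod_def using x that by (intro member_le_sum) auto
      thus ?thesis using x1 by (simp add: abs_le_square_iff[of "x $ k" 1, simplified] power2_eq_square)
    qed
    show "x \<bullet> (stiffness_matrix d n E p *\<^sub>v x) \<le> ?C"
      unfolding stiffness_quadratic_form[OF p x]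
    proof (rule sum_list_mono)
      fix e assume e: "e \<in> set (edge_list n E)"
      obtain u v where uv: "e = (u, v)" by fastforce
      have u: "u < n" and v: "v < n" using edge_list_bounds e unfolding uv by fastforce+
      have pv: "p v \<in> carrier_vec d" using p v by auto
      have index: "w * d + j < d * n" if "w < n" "j < d" for w j
      proof -
        have "w * d + j < Suc w * d" using that by simp
        also have "\<dots> \<le> n * d" using that by (intro mult_le_mono1) simp
        finally show ?thesis by (simp add: mult.commute)
      qed
      have "\<bar>\<Sum>j<d. unit_direction d p u v $ j * (x $ (u * d + j) - x $ (v * d + j))\<bar> \<le> (\<Sum>j<d. 1 * 2)"
      proof (rule order_trans[OF sum_abs sum_mono])
        fix j assume "j \<in> {..<d}"
        hence j: "j < d" by simp
        have "\<bar>x $ (u * d + j) - x $ (v * d + j)\<bar> \<le> 2"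
          using x_le[OF index[OF u j]] x_le[OF index[OF v j]] by linarith
        thus "\<bar>unit_direction d p u v $ j * (x $ (u * d + j) - x $ (v * d + j))\<bar> \<le> 1 * 2"
          unfolding abs_mult by (intro mult_mono abs_unit_direction_le_1[of p v, OF pv j]) auto
      qed
      hence "\<bar>\<Sum>j<d. unit_direction d p u v $ j * (x $ (u * d + j) - x $ (v * d + j))\<bar>\<^sup>2 \<le> (2 * real d)\<^sup>2"
        by (intro power_mono) auto
      thus "(case e of (u, v) \<Rightarrow>
          (kronecker_vec (unit_vec n u - unit_vec n v) (unit_direction d p u v) \<bullet> x)\<^sup>2) \<le> (2 * real d)\<^sup>2"
        unfolding uv prod.case kronecker_direction_scalar_prod[of p v, OF pv x u v] by simp
    qed
  qed
qed

section \<open>The cross-polytope realization of the complete graph\<close>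

text \<open>Passes from edges to ordered pairs, the form in which the rigidity estimate is stated;
  each edge is counted twice and the diagonal contributes nothing.\<close>

lemma sum_list_complete_edges:
  fixes f :: "nat \<Rightarrow> nat \<Rightarrow> real"
  assumes "\<And>u. f u u = 0" "\<And>u v. f u v = f v u"
  shows "2 * (\<Sum>(u, v)\<leftarrow>edge_list n (complete_edges n). f u v) = (\<Sum>u<n. \<Sum>v<n. f u v)"
proof -
  have set: "set (edge_list n (complete_edges n)) = {(u, v). u < v \<and> v < n}"
    by (fastforce simp: edge_list_def complete_edges_def)
  have dist: "distinct (edge_list n (complete_edges n))"
    by (simp add: edge_list_def distinct_product)
  let ?A = "{(u, v). u < v \<and> v < n}"
  let ?B = "{(u, v). v < u \<and> u < n}"
  have fin: "finite ?A" "finite ?B"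
    by (rule finite_subset[of _ "{..<n} \<times> {..<n}"]; auto)+
  have "(\<Sum>(u, v)\<in>?A. f u v) = (\<Sum>(u, v)\<in>?B. f u v)"
    by (rule sum.reindex_bij_witness[of _ prod.swap prod.swap]) (auto intro: assms(2))
  hence "2 * (\<Sum>(u, v)\<in>?A. f u v) = (\<Sum>(u, v)\<in>?A \<union> ?B. f u v)"
    by (subst sum.union_disjoint) (use fin in auto)
  also have "\<dots> = (\<Sum>(u, v)\<in>{..<n} \<times> {..<n}. f u v)"
    by (rule sum.mono_neutral_left) (auto simp: assms(1) not_less le_less)
  finally show ?thesis
    using dist by (simp add: sum_list_distinct_conv_sum_set set sum.cartesian_product)
qed

definition cross_point :: "nat \<Rightarrow> nat \<Rightarrow> real vec" where
  "cross_point d u = vec d (\<lambda>j. if j = u mod d then axis_sign d u else 0)"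

text \<open>Vertices in one class coincide and have direction zero. Otherwise the distance is 2 for
  antipodal points and \<open>sqrt 2\<close> for points on different axes, which yields the
  remaining cases of \<open>cross_form\<close>.\<close>

lemma unit_direction_cross_point:
  assumes d: "d > 0" and u: "g v < 2 * d" and w: "g v' < 2 * d"
  shows "(\<Sum>j<d. unit_direction d (\<lambda>v. cross_point d (g v)) v v' $ j * z j) = cross_form d (g v) (g v') z"
proof (cases "g v = g v'")
  case True
  thus ?thesis by (simp add: unit_direction_def cross_form_def)
next
  case False
  define a b s t where "a = g v mod d" and "b = g v' mod d" and "s = axis_sign d (g v)" and "t = axis_sign d (g v')"
  have ab: "a < d" "b < d" using d by (simp_all add: a_def b_def)
  have st: "s\<^sup>2 = 1" "t\<^sup>2 = 1" by (simp_all add: s_def t_def)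
  define q where "q = cross_point d (g v) - cross_point d (g v')"
  have q: "q \<in> carrier_vec d" by (simp add: q_def cross_point_def carrier_vecI)
  have qj: "q $ j = s * of_bool (j = a) - t * of_bool (j = b)" if "j < d" for j
    using that by (simp add: q_def cross_point_def a_def b_def s_def t_def)
  have pick: "(\<Sum>j<d. c * of_bool (j = i) * h j) = c * h i" if "i < d" for c i and h :: "nat \<Rightarrow> real"
    by (subst sum.remove[of _ i]) (use that in auto)
  have qz: "(\<Sum>j<d. q $ j * h j) = s * h a - t * h b" for h
  proof -
    have "(\<Sum>j<d. q $ j * h j) = (\<Sum>j<d. s * of_bool (j = a) * h j) - (\<Sum>j<d. t * of_bool (j = b) * h j)"
      by (simp add: qj left_diff_distrib sum_subtractf)
    thus ?thesis using ab by (simp only: pick)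
  qed
  have qq: "q \<bullet> q = s * q $ a - t * q $ b"
    using q qz[of "\<lambda>j. q $ j"] by (simp add: scalar_prod_def lessThan_atLeast0)
  \<comment> \<open>Two distinct indices below \<open>2 * d\<close> with the same residue modulo
    \<open>d\<close> are antipodal.\<close>
  have opposite: "t = - s" if "a = b"
    using that False u w unfolding a_def b_def s_def t_def axis_sign_def
    by (auto simp: mod_if split: if_splits)
  have norm: "q \<bullet> q = (if a = b then 4 else 2)"
    unfolding qq using ab st opposite by (auto simp: qj power2_eq_square algebra_simps)
  have "q \<noteq> 0\<^sub>v d" using norm by (auto split: if_splits)
  hence "cross_point d (g v) \<noteq> cross_point d (g v')"
    unfolding q_def by (auto simp: cross_point_def)
  hence dir: "unit_direction d (\<lambda>v. cross_point d (g v)) v v' = (1 / eucl_norm q) \<cdot>\<^sub>v q"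
    by (simp add: unit_direction_def q_def)
  have "(\<Sum>j<d. unit_direction d (\<lambda>v. cross_point d (g v)) v v' $ j * z j) = (\<Sum>j<d. q $ j * z j) / eucl_norm q"
    unfolding dir using q by (simp add: sum_divide_distrib)
  also have "\<dots> = cross_form d (g v) (g v') z"
    unfolding qz eucl_norm_def norm cross_form_def
    using False opposite by (auto simp: a_def b_def s_def t_def)
  finally show ?thesis .
qed

text \<open>Residues modulo \<open>m\<close> distribute the vertices evenly. The members of the
  class are \<open>q * m + u\<close>; every \<open>q < n div m\<close> occurs, and besides these at
  most \<open>q = n div m\<close>.\<close>

lemma card_residue_class:
  fixes m n u :: nat
  assumes u: "u < m"
  shows "n div m \<le> card {v\<in>{..<n}. v mod m = u}"
    and "card {v\<in>{..<n}. v mod m = u} \<le> n div m + 1"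
    and "m dvd n \<Longrightarrow> card {v\<in>{..<n}. v mod m = u} = n div m"
proof -
  define Q where "Q = {q. q * m + u < n}"
  have "{v\<in>{..<n}. v mod m = u} = (\<lambda>q. q * m + u) ` Q"
  proof (intro equalityI subsetI)
    fix v assume "v \<in> {v\<in>{..<n}. v mod m = u}"
    thus "v \<in> (\<lambda>q. q * m + u) ` Q"
      unfolding Q_def by (intro image_eqI[of _ _ "v div m"]) auto
  qed (use u in \<open>auto simp: Q_def\<close>)
  moreover have "inj_on (\<lambda>q. q * m + u) Q" using u by (auto simp: inj_on_def)
  ultimately have card: "card {v\<in>{..<n}. v mod m = u} = card Q" by (simp add: card_image)
  have "{..<n div m} \<subseteq> Q"
  proof
    fix q assume "q \<in> {..<n div m}"
    hence "Suc q * m \<le> n div m * m" by (intro mult_le_mono1) simp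
    also have "\<dots> \<le> n" by simp
    finally show "q \<in> Q" using u by (simp add: Q_def)
  qed
  moreover have Q_le: "Q \<subseteq> {..<n div m + 1}"
  proof
    fix q assume "q \<in> Q"
    hence "q * m \<le> n" by (simp add: Q_def)
    hence "q * m div m \<le> n div m" by (rule div_le_mono)
    thus "q \<in> {..<n div m + 1}" using u by simp
  qed
  moreover have fin: "finite Q" using Q_le by (rule finite_subset) simp
  ultimately show lower: "n div m \<le> card {v\<in>{..<n}. v mod m = u}"
    unfolding card using card_mono[of Q "{..<n div m}"] by simp
  show "card {v\<in>{..<n}. v mod m = u} \<le> n div m + 1"
    unfolding card using card_mono[OF _ Q_le] by simp
  assume "m dvd n"
  hence n: "n = n div m * m" by simp
  have "Q \<subseteq> {..<n div m}"
  proof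
    fix q assume "q \<in> Q"
    hence "q * m < n div m * m" using n by (simp add: Q_def)
    thus "q \<in> {..<n div m}" by simp
  qed
  from card_mono[OF _ this] show "card {v\<in>{..<n}. v mod m = u} = n div m"
    using lower unfolding card by simp
qed

text \<open>The pairs index the linear conditions: \<open>(i, i)\<close> for the translations and
  \<open>i < j\<close> for the rotations. Their number matches the eigenvalue index in
  \<open>algebraic_connectivity\<close>.\<close>

lemma card_pairs_le: "card {(i, j). i \<le> j \<and> j < d} = (d + 1) choose 2" for d :: nat
proof (induction d)
  case (Suc d)
  have "{(i, j). i \<le> j \<and> j < Suc d} = {(i, j). i \<le> j \<and> j < d} \<union> (\<lambda>i. (i, d)) ` {..d}"
    by auto
  moreover have "finite {(i, j). i \<le> j \<and> j < d}"
    by (rule finite_subset[of _ "{..<d} \<times> {..<d}"]) auto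
  ultimately have "card {(i, j). i \<le> j \<and> j < Suc d} = card {(i, j). i \<le> j \<and> j < d} + card ((\<lambda>i. (i, d)) ` {..d})"
    by (simp only:) (subst card_Un_disjoint; auto)
  also have "card ((\<lambda>i. (i, d)) ` {..d}) = Suc d"
    by (subst card_image) (auto simp: inj_on_def)
  finally show ?case using Suc.IH by (simp add: numeral_2_eq_2)
qed (simp add: numeral_2_eq_2)

text \<open>A single realization bounds the supremum from below: vertex \<open>v\<close> is placed
  at the cross-polytope vertex numbered \<open>v mod (2 * d)\<close>. The parameters
  \<open>k\<close>, \<open>M\<close> and \<open>\<kappa>\<close> stay free so that both equal and
  unequal classes are covered.\<close>

lemma algebraic_connectivity_complete_ge:
  fixes d n k M :: nat
  assumes d: "d > 0" and n: "n \<ge> 2 * d"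
    and lower: "\<And>u. u < 2 * d \<Longrightarrow> k \<le> card {v\<in>{..<n}. v mod (2 * d) = u}"
    and upper: "\<And>u. u < 2 * d \<Longrightarrow> card {v\<in>{..<n}. v mod (2 * d) = u} \<le> M"
    and k: "0 < k" and \<kappa>: "0 \<le> \<kappa>" "\<kappa> \<le> real k" "\<kappa> * real M \<le> (real k)\<^sup>2"
  shows "\<kappa> \<le> algebraic_connectivity d n (complete_edges n)"
proof -
  define g where "g v = v mod (2 * d)" for v
  define p where "p v = cross_point d (g v)" for v
  define m where "m u = card {v\<in>{..<n}. g v = u}" for u
  \<comment> \<open>Coefficients of the functional that takes coordinate \<open>c\<close> of the
    mean over class \<open>u\<close>; \<open>l div d\<close> is the vertex and
    \<open>l mod d\<close> the coordinate of entry \<open>l\<close>.\<close>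
  define \<mu> where "\<mu> u c l = (if g (l div d) = u \<and> l mod d = c then 1 / real (m u) else 0)" for u c l
  \<comment> \<open>The translation condition for \<open>i = j\<close>, the rotation condition for
    \<open>i < j\<close>, written as coefficients of linear functionals.\<close>
  define w where "w = (\<lambda>(i, j) l. if i = j then \<Sum>u<2*d. \<mu> u i l
    else \<mu> i j l - \<mu> (d + i) j l - \<mu> j i l + \<mu> (d + j) i l)"
  define I where "I = {(i, j). i \<le> j \<and> j < d}"
  have g: "g v < 2 * d" for v using d by (simp add: g_def)
  have p: "p \<in> {0..<n} \<rightarrow> carrier_vec d" by (simp add: p_def cross_point_def)
  have cardI: "card I = (d + 1) choose 2" unfolding I_def by (rule card_pairs_le)
  have finI: "finite I" unfolding I_def by (rule finite_subset[of _ "{..<d} \<times> {..<d}"]) auto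
  \<comment> \<open>The number of conditions must be less than the dimension \<open>d * n\<close>,
    so that the eigenvalue in question exists.\<close>
  have "(d + 1) choose 2 = d * (d + 1) div 2" by (simp add: choose_two mult.commute)
  also have "\<dots> \<le> d * (2 * d) div 2" using d by (intro div_le_mono mult_le_mono2) simp
  also have "\<dots> = d * d" by simp
  also have "\<dots> < d * n" using n d by simp
  finally have small: "card I < d * n" unfolding cardI .
  have "\<kappa> \<le> nth_eigenvalue (card I + 1) (stiffness_matrix d n (complete_edges n) p)"
  proof (rule nth_eigenvalue_ge[OF stiffness_matrix_carrier stiffness_matrix_symmetric finI small, where w = w])
    fix x :: "real vec"
    assume x: "x \<in> carrier_vec (d * n)"
      and orth: "\<And>i. i \<in> I \<Longrightarrow> (\<Sum>l<d*n. w i l * x $ l) = 0"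
    define y where "y v c = x $ (v * d + c)" for v c
    define X where "X u c = (\<Sum>l<d*n. \<mu> u c l * x $ l)" for u c
    have mean: "real (card {v\<in>{..<n}. g v = u}) * X u c = (\<Sum>v | v \<in> {..<n} \<and> g v = u. y v c)"
      if u: "u < 2 * d" and c: "c < d" for u c
    proof -
      \<comment> \<open>Nonempty classes make the division by \<open>m u\<close> meaningful.\<close>
      have m0: "m u > 0" using lower[OF u] k unfolding m_def g_def by simp
      have "X u c = (\<Sum>v<n. \<Sum>j<d. if j = c then (if g v = u then y v c / real (m u) else 0) else 0)"
        unfolding X_def sum_lessThan_mult \<mu>_def y_def by (intro sum.cong refl) auto
      also have "\<dots> = (\<Sum>v<n. if g v = u then y v c / real (m u) else 0)" using c by simp
      also have "\<dots> = (\<Sum>v | v \<in> {..<n} \<and> g v = u. y v c / real (m u))"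
        by (rule sum.inter_filter[symmetric]) simp
      also have "\<dots> = (\<Sum>v | v \<in> {..<n} \<and> g v = u. y v c) / real (m u)"
        by (rule sum_divide_distrib[symmetric])
      finally show ?thesis unfolding m_def[symmetric] using m0 by simp
    qed
    have translation: "(\<Sum>u<2*d. X u i) = 0" if "i < d" for i
    proof -
      have "(\<Sum>u<2*d. X u i) = (\<Sum>l<d*n. w (i, i) l * x $ l)"
        unfolding X_def w_def by (subst sum.swap) (simp add: sum_distrib_right)
      thus ?thesis using orth[of "(i, i)"] that by (simp add: I_def)
    qed
    have rotation: "X i j - X (d + i) j = X j i - X (d + j) i" if "i < j" "j < d" for i j
    proof -
      have "X i j - X (d + i) j - X j i + X (d + j) i = (\<Sum>l<d*n. w (i, j) l * x $ l)"
        unfolding X_def w_def using that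
        by (simp add: algebra_simps sum.distrib sum_subtractf)
      thus ?thesis using orth[of "(i, j)"] that by (simp add: I_def)
    qed
    have form: "(kronecker_vec (unit_vec n u - unit_vec n v) (unit_direction d p u v) \<bullet> x)\<^sup>2 =
        (cross_form d (g u) (g v) (\<lambda>c. y u c - y v c))\<^sup>2" if "u < n" "v < n" for u v
    proof -
      have "p v \<in> carrier_vec d" using p that by auto
      from kronecker_direction_scalar_prod[of p v, OF this x that]
      show ?thesis unfolding p_def y_def by (simp add: unit_direction_cross_point[of d g, OF d g g])
    qed
    have "(\<Sum>(u, v)\<leftarrow>edge_list n (complete_edges n).
          (kronecker_vec (unit_vec n u - unit_vec n v) (unit_direction d p u v) \<bullet> x)\<^sup>2) =
        (\<Sum>(u, v)\<leftarrow>edge_list n (complete_edges n). (cross_form d (g u) (g v) (\<lambda>c. y u c - y v c))\<^sup>2)"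
    proof (rule arg_cong[of _ _ sum_list], rule map_cong[OF refl])
      fix e assume e: "e \<in> set (edge_list n (complete_edges n))"
      obtain u v where uv: "e = (u, v)" by fastforce
      have "u < n" "v < n" using edge_list_bounds e unfolding uv by fastforce+
      from form[OF this] show "(case e of (u, v) \<Rightarrow>
            (kronecker_vec (unit_vec n u - unit_vec n v) (unit_direction d p u v) \<bullet> x)\<^sup>2) =
          (case e of (u, v) \<Rightarrow> (cross_form d (g u) (g v) (\<lambda>c. y u c - y v c))\<^sup>2)"
        unfolding uv by simp
    qed
    also have "2 * \<dots> = (\<Sum>u<n. \<Sum>v<n. (cross_form d (g u) (g v) (\<lambda>c. y u c - y v c))\<^sup>2)"
    proof (rule sum_list_complete_edges)
      fix u v
      have "cross_form d (g u) (g v) (\<lambda>c. y u c - y v c) = - cross_form d (g u) (g v) (\<lambda>c. y v c - y u c)"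
        by (simp add: cross_form_diff)
      thus "(cross_form d (g u) (g v) (\<lambda>c. y u c - y v c))\<^sup>2 = (cross_form d (g v) (g u) (\<lambda>c. y v c - y u c))\<^sup>2"
        by (simp add: cross_form_commute_square[of d "g u"])
    qed (simp add: cross_form_def)
    finally have "2 * (x \<bullet> (stiffness_matrix d n (complete_edges n) p *\<^sub>v x)) =
        (\<Sum>u<n. \<Sum>v<n. (cross_form d (g u) (g v) (\<lambda>c. y u c - y v c))\<^sup>2)"
      unfolding stiffness_quadratic_form[OF p x] .
    moreover have "2 * \<kappa> * (\<Sum>v<n. \<Sum>c<d. (y v c)\<^sup>2) \<le>
        (\<Sum>u<n. \<Sum>v<n. (cross_form d (g u) (g v) (\<lambda>c. y u c - y v c))\<^sup>2)"
      by (rule blown_up_cross_polytope_rigidity[of n g d k M X, OF g _ _ mean translation rotation \<kappa>])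
        (use lower upper in \<open>simp_all add: g_def\<close>)
    moreover have "x \<bullet> x = (\<Sum>v<n. \<Sum>c<d. (y v c)\<^sup>2)"
      using x by (simp add: scalar_prod_def y_def power2_eq_square sum_lessThan_mult flip: lessThan_atLeast0)
    ultimately show "\<kappa> * (x \<bullet> x) \<le> x \<bullet> (stiffness_matrix d n (complete_edges n) p *\<^sub>v x)" by simp
  qed
  also have "\<dots> \<le> algebraic_connectivity d n (complete_edges n)"
    unfolding algebraic_connectivity_def cardI
    by (rule cSUP_upper[OF p bdd_above_nth_eigenvalue_stiffness]) (use small cardI in simp)
  finally show ?thesis .
qed

theorem theorem1p5:
  fixes d n :: nat
  assumes "d \<ge> 3" and "n \<ge> 2 * d"
  shows "(2 * d dvd n \<longrightarrow>
            algebraic_connectivity d n (complete_edges n) \<ge> real n / real (2 * d)) \<and>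
         algebraic_connectivity d n (complete_edges n) \<ge>
            real_of_int (\<lceil>real n / real (2 * d)\<rceil> - 2 * int d + 1)"
proof -
  define k where "k = n div (2 * d)"
  have d: "d > 0" using assms(1) by simp
  have k: "k > 0" unfolding k_def using assms d by (simp add: div_greater_zero_iff)
  note card = card_residue_class[of _ "2 * d" n, folded k_def]
  have divisible: "algebraic_connectivity d n (complete_edges n) \<ge> real n / real (2 * d)" if "2 * d dvd n"
  proof -
    have "real k \<le> algebraic_connectivity d n (complete_edges n)"
      by (rule algebraic_connectivity_complete_ge[of d n k k, OF d assms(2)])
        (use card(3) that k in \<open>auto simp: power2_eq_square\<close>)
    thus ?thesis unfolding k_def using that by (simp add: real_of_nat_div)
  qed
  \<comment> \<open>Class sizes are \<open>k\<close> or \<open>k + 1\<close>, and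
    \<open>(k - 1) * (k + 1) = k * k - 1\<close> is at most \<open>k * k\<close>, so
    \<open>\<kappa> = k - 1\<close> is admissible.\<close>
  have general: "real k - 1 \<le> algebraic_connectivity d n (complete_edges n)"
    by (rule algebraic_connectivity_complete_ge[of d n k "k + 1", OF d assms(2)])
      (use card(1,2) k in \<open>auto simp: power2_eq_square algebra_simps\<close>)
  have "n \<le> (k + 1) * (2 * d)" unfolding k_def using d dividend_less_times_div[of "2 * d" n]
    by (simp add: mult.commute)
  hence "real n \<le> real ((k + 1) * (2 * d))" by (simp only: of_nat_le_iff)
  also have "\<dots> = (real k + 1) * real (2 * d)" by (simp add: algebra_simps)
  finally have "real n / real (2 * d) \<le> real k + 1" using d by (simp add: divide_le_eq)
  hence "\<lceil>real n / real (2 * d)\<rceil> \<le> int k + 1" by (simp add: ceiling_le_iff)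
  \<comment> \<open>The ceiling is at most \<open>k + 1\<close>, and subtracting
    \<open>2 * d - 1\<close> lowers it by at least 2.\<close>
  hence "\<lceil>real n / real (2 * d)\<rceil> - 2 * int d + 1 \<le> int k - 1" using assms(1) by linarith
  hence "real_of_int (\<lceil>real n / real (2 * d)\<rceil> - 2 * int d + 1) \<le> real_of_int (int k - 1)"
    by (simp only: of_int_le_iff)
  thus ?thesis using divisible general by auto
qed

end
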